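(* For every integer $k \geq 2$ there exists a connected outerplanar graph $G_k$ of maximum degree $3$ with at most $24k + 16k\lceil \log_2 k \rceil - 1$ vertices such that $z(G_k) \geq k$, i.e. for every placement of at most $k-1$ zombies on $G_k$ the survivor has a strategy to avoid capture forever.
   Context: All graphs are finite, simple and undirected. The (deterministic) zombies-and-survivor game on a connected graph $G$: in round $0$ the zombies choose starting vertices (several zombies may share a vertex), then the survivor chooses a starting vertex. In each subsequent round, first every zombie must move from its current vertex $u$ to a neighbour $w$ of $u$ that lies on a shortest path in $G$ from $u$ to the survivor's current vertex (if several such $w$ exist, the zombies choose); then the survivor either stays put or moves to an adjacent vertex. Both sides have full information. The zombies win if at some moment a zombie occupies the survivor's vertex; the survivor wins if this never happens. The zombie number $z(G)$ is the minimum number of zombies for which the zombies (choosing their starting positions) have a winning strategy. *)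

theory Defs
  imports "HOL-Analysis.Analysis" "Graph_Theory.Graph_Theory"
begin

text \<open>
  A finite simple undirected graph is a \<^locale>\<open>pair_graph\<close>: a finite loop-free digraph with a
  symmetric arc relation, an undirected edge being a pair of opposite arcs. Hence the degree
  of a vertex is its out-degree.
\<close>

definition max_degree :: "'a pair_pre_digraph \<Rightarrow> nat" where
  "max_degree G = Max (out_degree (with_proj G) ` pverts G)"


subsection \<open>Outerplanarity\<close>

text \<open>
  Edges are drawn as simple arcs. The two orientations of an edge share one curve; curves of
  different edges meet only in common end vertices, and no curve passes through a third vertex.
\<close>

definition plane_drawing ::
  "'a pair_pre_digraph \<Rightarrow> ('a \<Rightarrow> complex) \<Rightarrow> ('a \<times> 'a \<Rightarrow> real \<Rightarrow> complex) \<Rightarrow> bool" where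
  "plane_drawing G pos \<gamma> \<longleftrightarrow>
     inj_on pos (pverts G) \<and>
     (\<forall>(u, v) \<in> parcs G.
        arc (\<gamma> (u, v)) \<and> pathstart (\<gamma> (u, v)) = pos u \<and> pathfinish (\<gamma> (u, v)) = pos v \<and>
        \<gamma> (v, u) = reversepath (\<gamma> (u, v)) \<and>
        path_image (\<gamma> (u, v)) \<inter> pos ` pverts G = {pos u, pos v}) \<and>
     (\<forall>(u, v) \<in> parcs G. \<forall>(x, y) \<in> parcs G. {u, v} \<noteq> {x, y} \<longrightarrow>
        path_image (\<gamma> (u, v)) \<inter> path_image (\<gamma> (x, y)) \<subseteq> pos ` ({u, v} \<inter> {x, y}))"

definition drawing_image ::
  "'a pair_pre_digraph \<Rightarrow> ('a \<Rightarrow> complex) \<Rightarrow> ('a \<times> 'a \<Rightarrow> real \<Rightarrow> complex) \<Rightarrow> complex set" where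
  "drawing_image G pos \<gamma> = pos ` pverts G \<union> (\<Union>e \<in> parcs G. path_image (\<gamma> e))"

text \<open>
  The drawing of a finite graph is compact, so \<^const>\<open>outside\<close> of its image is the
  unbounded (outer) face; every vertex has to lie on the boundary of that face.
\<close>

definition outerplanar :: "'a pair_pre_digraph \<Rightarrow> bool" where
  "outerplanar G \<longleftrightarrow>
     (\<exists>pos \<gamma>. plane_drawing G pos \<gamma> \<and>
        (\<forall>v \<in> pverts G. pos v \<in> frontier (outside (drawing_image G pos \<gamma>))))"


subsection \<open>Zombies and survivor\<close>

definition shortest_path :: "'a pair_pre_digraph \<Rightarrow> 'a \<Rightarrow> ('a \<times> 'a) awalk \<Rightarrow> 'a \<Rightarrow> bool" where
  "shortest_path G u p v \<longleftrightarrow>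
     pre_digraph.apath (with_proj G) u p v \<and>
     (\<forall>q. pre_digraph.apath (with_proj G) u q v \<longrightarrow> length p \<le> length q)"

definition zombie_move :: "'a pair_pre_digraph \<Rightarrow> 'a \<Rightarrow> 'a \<Rightarrow> 'a \<Rightarrow> bool" where
  "zombie_move G s u w \<longleftrightarrow>
     (u, w) \<in> parcs G \<and> (\<exists>p. shortest_path G u p s \<and> w \<in> set (pawalk_verts u p))"

text \<open>The positions of \<open>m\<close> zombies form a list of length \<open>m\<close>, the \<open>i\<close>-th entry belonging to
  the \<open>i\<close>-th zombie.\<close>

definition placement :: "'a pair_pre_digraph \<Rightarrow> nat \<Rightarrow> 'a list \<Rightarrow> bool" where
  "placement G m Z \<longleftrightarrow> length Z = m \<and> set Z \<subseteq> pverts G"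

definition zombies_move :: "'a pair_pre_digraph \<Rightarrow> 'a \<Rightarrow> 'a list \<Rightarrow> 'a list \<Rightarrow> bool" where
  "zombies_move G s Z Z' \<longleftrightarrow> list_all2 (zombie_move G s) Z Z'"

definition survivor_move :: "'a pair_pre_digraph \<Rightarrow> 'a \<Rightarrow> 'a \<Rightarrow> bool" where
  "survivor_move G s s' \<longleftrightarrow> s' = s \<or> (s, s') \<in> parcs G"

text \<open>
  A play is given by the positions \<open>Z n\<close> of the zombies and \<open>s n\<close> of the survivor at the end of
  each round \<open>n\<close>. In round \<open>n > 0\<close> the zombies move from \<open>Z (n - 1)\<close> to \<open>Z n\<close> while the survivor
  is still at \<open>s (n - 1)\<close>, so a capture in this round can happen at two moments.
\<close>

definition captured_in_round :: "(nat \<Rightarrow> 'a list) \<Rightarrow> (nat \<Rightarrow> 'a) \<Rightarrow> nat \<Rightarrow> bool" where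
  "captured_in_round Z s n \<longleftrightarrow> (0 < n \<and> s (n - 1) \<in> set (Z n)) \<or> s n \<in> set (Z n)"

text \<open>
  A strategy maps the list of all previous choices of the opponent to the next choice; in
  particular a zombie strategy maps \<open>[]\<close> to the initial placement. Whoever uses the strategy has
  to move legally for as long as the game is not decided. After a capture there need not be any
  legal zombie move, hence legality of the zombies' moves is only ever required up to a finite
  round.
\<close>

definition zombies_winning_strategy ::
  "'a pair_pre_digraph \<Rightarrow> nat \<Rightarrow> ('a list \<Rightarrow> 'a list) \<Rightarrow> bool" where
  "zombies_winning_strategy G m \<tau> \<longleftrightarrow>
     placement G m (\<tau> []) \<and>
     (\<forall>s. s 0 \<in> pverts G \<and> (\<forall>n. survivor_move G (s n) (s (Suc n))) \<longrightarrow>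
        (let Z = (\<lambda>n. \<tau> (map s [0..<n])) in
          \<exists>N. (\<forall>n<N. zombies_move G (s n) (Z n) (Z (Suc n))) \<and> captured_in_round Z s N))"

definition survivor_winning_strategy ::
  "'a pair_pre_digraph \<Rightarrow> 'a list \<Rightarrow> ('a list list \<Rightarrow> 'a) \<Rightarrow> bool" where
  "survivor_winning_strategy G Z\<^sub>0 \<sigma> \<longleftrightarrow>
     (\<forall>Z. Z 0 = Z\<^sub>0 \<longrightarrow>
        (let s = (\<lambda>n. \<sigma> (map Z [0..<Suc n])) in
          s 0 \<in> pverts G \<and>
          (\<forall>N. (\<forall>n<N. zombies_move G (s n) (Z n) (Z (Suc n))) \<longrightarrow>
             (\<forall>n<N. survivor_move G (s n) (s (Suc n))) \<and> \<not> captured_in_round Z s N)))"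

definition zombie_number :: "'a pair_pre_digraph \<Rightarrow> nat" where
  "zombie_number G = (LEAST m. \<exists>\<tau>. zombies_winning_strategy G m \<tau>)"

end

theory Submission
  imports Defs
begin

text \<open>
  Let \<open>l = \<lceil>log 2 k\<rceil>\<close> and \<open>m = 2l + 2\<close>. Hang \<open>k\<close> gadgets on the leaves of a binary tree of depth \<open>l\<close>;
  a gadget is a cycle of length \<open>8m\<close> with a chord that splits it into two cycles \<open>A\<close> and \<open>B\<close> of length
  \<open>4m + 1\<close>, attached at a vertex of \<open>A\<close>. With fewer than \<open>k\<close> zombies some gadget contains none. The
  survivor starts there next to the attaching vertex and, whatever the zombies do, runs through the
  long side of \<open>A\<close> and then around \<open>B\<close> forever. A zombie that enters the gadget early is less than half
  of \<open>A\<close> behind her, so it has to follow her. A zombie that enters later takes the short side of \<open>A\<close>,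
  but gets to the chord only after she has passed it; since every zombie enters after at most
  \<open>2l + 3m = 4m - 2\<close> rounds, it then is less than half of \<open>B\<close> behind her. So each zombie ends up
  following her around \<open>B\<close> at a constant distance.
\<close>

subsection \<open>Noncrossing graphs are outerplanar\<close>

text \<open>Draw the vertex \<open>i\<close> at \<open>(i, i\<^sup>2)\<close> and the edges as straight chords of the parabola.\<close>

definition parabola_pt :: "nat \<Rightarrow> complex" where
  "parabola_pt i = Complex (real i) ((real i)\<^sup>2)"

lemma inj_parabola_pt: "inj parabola_pt"
  by (auto simp: inj_on_def parabola_pt_def)

text \<open>The secant of y = x^2 through u and v has slope u + v, so its points are determined by
  their real parts, and intersection questions become one-dimensional.\<close>

lemma chord_Re_Im:
  assumes "z \<in> closed_segment (parabola_pt u) (parabola_pt v)" "u \<le> v"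
  shows "real u \<le> Re z" "Re z \<le> real v" "Im z = (real u + real v) * Re z - real u * real v"
proof -
  obtain t where t: "0 \<le> t" "t \<le> 1" "z = (1 - t) *\<^sub>R parabola_pt u + t *\<^sub>R parabola_pt v"
    using assms(1) by (auto simp: closed_segment_def)
  have re: "Re z = real u + t * (real v - real u)"
    by (simp add: t parabola_pt_def algebra_simps)
  show "real u \<le> Re z" unfolding re using t(1) assms(2) by simp
  have "t * (real v - real u) \<le> 1 * (real v - real u)"
    using t(2) assms(2) by (intro mult_right_mono) auto
  then show "Re z \<le> real v" unfolding re by simp
  show "Im z = (real u + real v) * Re z - real u * real v"
    unfolding re by (simp add: t parabola_pt_def algebra_simps power2_eq_square)
qed

lemma eq_parabola_pt_iff: "z = parabola_pt i \<longleftrightarrow> Re z = real i \<and> Im z = (real i)\<^sup>2"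
  by (auto simp: complex_eq_iff parabola_pt_def)

text \<open>\<open>(x - a) * (b - x)\<close> is the height of the chord from a to b above the
  parabola at x. The outer height minus the inner one is a sum of two nonnegative products, so
  equality makes both vanish.\<close>

lemma chord_nested_meet:
  fixes x a b p q :: real
  assumes "a \<le> p" "p \<le> x" "x \<le> q" "q \<le> b" "(x - a) * (b - x) = (x - p) * (q - x)"
  shows "(x = p \<and> p = a) \<or> (x = q \<and> q = b) \<or> (a = p \<and> b = q)"
proof -
  have "(p - a) * (b - x) + (x - p) * (b - q) = 0"
    using assms(5) by (simp add: algebra_simps)
  moreover have "(p - a) * (b - x) \<ge> 0" "(x - p) * (b - q) \<ge> 0"
    using assms by auto
  ultimately have "(p - a) * (b - x) = 0" "(x - p) * (b - q) = 0" by linarith+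
  then show ?thesis using assms by auto
qed

lemma chord_inter_nested:
  assumes z: "z \<in> closed_segment (parabola_pt u) (parabola_pt v)"
      "z \<in> closed_segment (parabola_pt x) (parabola_pt y)"
    and le: "u \<le> x" "x < y" "y \<le> v" and ne: "(u, v) \<noteq> (x, y)"
  shows "z \<in> parabola_pt ` ({u, v} \<inter> {x, y})"
proof -
  have uv: "u \<le> v" "x \<le> y" using le by auto
  note 1 = chord_Re_Im[OF z(1) uv(1)] and 2 = chord_Re_Im[OF z(2) uv(2)]
  have "(Re z - real u) * (real v - Re z) = (Re z - real x) * (real y - Re z)"
    using 1(3) 2(3) by (simp add: algebra_simps)
  then have "(Re z = real x \<and> real x = real u) \<or> (Re z = real y \<and> real y = real v)
      \<or> (real u = real x \<and> real v = real y)"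
    using le 2(1,2) by (intro chord_nested_meet) auto
  then show ?thesis
  proof (elim disjE conjE)
    assume *: "Re z = real x" "real x = real u"
    then have "z = parabola_pt x"
      using 2(3) by (simp add: eq_parabola_pt_iff algebra_simps power2_eq_square)
    then show ?thesis using * by auto
  next
    assume *: "Re z = real y" "real y = real v"
    then have "z = parabola_pt y"
      using 2(3) by (simp add: eq_parabola_pt_iff algebra_simps power2_eq_square)
    then show ?thesis using * by auto
  qed (use ne in auto)
qed

lemma chord_inter_consecutive:
  assumes z: "z \<in> closed_segment (parabola_pt u) (parabola_pt v)"
      "z \<in> closed_segment (parabola_pt x) (parabola_pt y)"
    and le: "u < v" "v \<le> x" "x < y"
  shows "z \<in> parabola_pt ` ({u, v} \<inter> {x, y})"
proof -
  have uv: "u \<le> v" "x \<le> y" using le by auto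
  note 1 = chord_Re_Im[OF z(1) uv(1)] and 2 = chord_Re_Im[OF z(2) uv(2)]
  have "real v \<le> real x" using le by simp
  then have *: "Re z = real v" "v = x" using 1(2) 2(1) by linarith+
  then have "z = parabola_pt v"
    using 1(3) by (simp add: eq_parabola_pt_iff algebra_simps power2_eq_square)
  then show ?thesis using * by auto
qed

lemma chord_inter:
  assumes "z \<in> closed_segment (parabola_pt u) (parabola_pt v)"
      "z \<in> closed_segment (parabola_pt x) (parabola_pt y)"
    and "u < v" "x < y" and "(u, v) \<noteq> (x, y)"
    and "\<not> (u < x \<and> x < v \<and> v < y)" "\<not> (x < u \<and> u < y \<and> y < v)"
  shows "z \<in> parabola_pt ` ({u, v} \<inter> {x, y})"
proof -
  consider "v \<le> x" | "y \<le> u" | "u \<le> x" "y \<le> v" | "x \<le> u" "v \<le> y"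
    using assms(3-) by linarith
  then show ?thesis
  proof cases
    case 1 then show ?thesis using assms by (intro chord_inter_consecutive)
  next
    case 2 then show ?thesis using chord_inter_consecutive[of z x y u v] assms by (simp add: Int_commute)
  next
    case 3 then show ?thesis using assms by (intro chord_inter_nested)
  next
    case 4 then show ?thesis using chord_inter_nested[of z x y u v] assms by (auto simp: Int_commute)
  qed
qed

lemma parabola_pt_on_chord:
  assumes "parabola_pt w \<in> closed_segment (parabola_pt u) (parabola_pt v)" "u < v"
  shows "w = u \<or> w = v"
proof -
  have "(real w)\<^sup>2 = (real u + real v) * real w - real u * real v"
    using chord_Re_Im(3)[OF assms(1)] assms(2) by (simp add: parabola_pt_def)
  then have "(real w - real u) * (real w - real v) = 0"
    by (simp add: algebra_simps power2_eq_square)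
  then show ?thesis by auto
qed

lemma chord_above_parabola:
  assumes "z \<in> closed_segment (parabola_pt u) (parabola_pt v)" "u \<le> v"
  shows "(Re z)\<^sup>2 \<le> Im z"
proof -
  have "0 \<le> (Re z - real u) * (real v - Re z)"
    using chord_Re_Im(1,2)[OF assms] by simp
  then show ?thesis
    using chord_Re_Im(3)[OF assms] by (simp add: algebra_simps power2_eq_square)
qed

text \<open>The vertical ray down from \<open>z\<close> misses \<open>S\<close>, is connected and
  unbounded.\<close>

lemma below_parabola_outside:
  assumes "\<And>z. z \<in> S \<Longrightarrow> (Re z)\<^sup>2 \<le> Im z" and "Im z < (Re z)\<^sup>2"
  shows "z \<in> outside S"
proof -
  define T where "T = {w. Re w = Re z \<and> Im w \<le> Im z}"
  have "convex T"
    unfolding convex_def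
  proof (intro ballI allI impI)
    fix a b :: complex and u v :: real
    assume *: "a \<in> T" "b \<in> T" "0 \<le> u" "0 \<le> v" "u + v = 1"
    then have "u * Im a + v * Im b \<le> u * Im z + v * Im z"
      by (intro add_mono mult_left_mono) (auto simp: T_def)
    also have "\<dots> = Im z" using * by (simp flip: distrib_right)
    finally show "u *\<^sub>R a + v *\<^sub>R b \<in> T"
      using * by (simp add: T_def flip: distrib_right)
  qed
  moreover have "T \<subseteq> - S" using assms by (force simp: T_def)
  moreover have "z \<in> T" by (simp add: T_def)
  ultimately have sub: "T \<subseteq> connected_component_set (- S) z"
    by (intro connected_component_maximal convex_connected)
  have "\<not> bounded T"
  proof
    assume "bounded T"
    then obtain B where B: "\<And>w. w \<in> T \<Longrightarrow> norm w \<le> B" by (auto simp: bounded_iff)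
    define w where "w = Complex (Re z) (min (Im z) (- \<bar>B\<bar> - 1))"
    have "w \<in> T" by (simp add: T_def w_def)
    then have "\<bar>Im w\<bar> \<le> B" using B abs_Im_le_cmod order_trans by blast
    then show False by (simp add: w_def min_def split: if_splits)
  qed
  then have "\<not> bounded (connected_component_set (- S) z)"
    using sub bounded_subset by blast
  moreover have "z \<notin> S" using assms by force
  ultimately show ?thesis by (simp add: outside_def)
qed

text \<open>Chords lie on or above the parabola, so each vertex is a limit of points just below it,
  which belong to the outer face. Using \<open>nc\<close> for both orders of a pair of edges
  excludes every crossing.\<close>

lemma outerplanar_if_noncrossing:
  fixes V :: "nat set" and E :: "nat rel"
  assumes E: "\<And>u v. (u, v) \<in> E \<Longrightarrow> u \<in> V \<and> v \<in> V \<and> u < v"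
    and nc: "\<And>u v x y. (u, v) \<in> E \<Longrightarrow> (x, y) \<in> E \<Longrightarrow> \<not> (u < x \<and> x < v \<and> v < y)"
  shows "outerplanar \<lparr>pverts = V, parcs = E \<union> E\<inverse>\<rparr>"
proof -
  let ?G = "\<lparr>pverts = V, parcs = E \<union> E\<inverse>\<rparr>"
  define \<gamma> where "\<gamma> = (\<lambda>(u, v). linepath (parabola_pt u) (parabola_pt v))"
  have pos_eq: "parabola_pt u = parabola_pt v \<longleftrightarrow> u = v" for u v
    using inj_parabola_pt by (auto simp: inj_on_def)
  have ends: "path_image (\<gamma> (u, v)) \<inter> parabola_pt ` V = {parabola_pt u, parabola_pt v}"
    if "(u, v) \<in> E" for u v
    using that E[OF that] by (auto simp: \<gamma>_def dest: parabola_pt_on_chord)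
  have ends': "path_image (\<gamma> (u, v)) \<inter> parabola_pt ` V = {parabola_pt u, parabola_pt v}"
    if "(v, u) \<in> E" for u v
    using ends[OF that] by (simp add: \<gamma>_def closed_segment_commute insert_commute)
  have cr: "path_image (\<gamma> (u, v)) \<inter> path_image (\<gamma> (x, y)) \<subseteq> parabola_pt ` ({u, v} \<inter> {x, y})"
    if "(u, v) \<in> E" "(x, y) \<in> E" "{u, v} \<noteq> {x, y}" for u v x y
  proof
    fix z assume "z \<in> path_image (\<gamma> (u, v)) \<inter> path_image (\<gamma> (x, y))"
    then show "z \<in> parabola_pt ` ({u, v} \<inter> {x, y})"
      using that E nc[OF that(1,2)] nc[OF that(2,1)]
      by (intro chord_inter) (auto simp: \<gamma>_def)
  qed
  have rev: "path_image (\<gamma> (v, u)) = path_image (\<gamma> (u, v))" for u v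
    by (simp add: \<gamma>_def closed_segment_commute)
  have cr': "path_image (\<gamma> (u, v)) \<inter> path_image (\<gamma> (x, y)) \<subseteq> parabola_pt ` ({u, v} \<inter> {x, y})"
    if "(u, v) \<in> E \<union> E\<inverse>" "(x, y) \<in> E \<union> E\<inverse>" "{u, v} \<noteq> {x, y}" for u v x y
    using that cr[of u v x y] cr[of v u x y] cr[of u v y x] cr[of v u y x]
    by (auto simp: rev[of v u] rev[of y x] insert_commute)
  have arcs: "arc (\<gamma> (u, v)) \<and> pathstart (\<gamma> (u, v)) = parabola_pt u
      \<and> pathfinish (\<gamma> (u, v)) = parabola_pt v \<and> \<gamma> (v, u) = reversepath (\<gamma> (u, v))
      \<and> path_image (\<gamma> (u, v)) \<inter> parabola_pt ` V = {parabola_pt u, parabola_pt v}"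
    if "(u, v) \<in> E \<union> E\<inverse>" for u v
  proof -
    have "u \<noteq> v" using that E by force
    moreover have "path_image (\<gamma> (u, v)) \<inter> parabola_pt ` V = {parabola_pt u, parabola_pt v}"
      using that ends[of u v] ends'[of v u] by blast
    ultimately show ?thesis by (simp add: \<gamma>_def pos_eq arc_linepath del: path_image_linepath)
  qed
  have "inj_on parabola_pt V" using inj_parabola_pt inj_on_subset by blast
  then have "plane_drawing ?G parabola_pt \<gamma>"
    using arcs cr' unfolding plane_drawing_def pair_pre_digraph.simps by blast
  moreover have "parabola_pt v \<in> frontier (outside (drawing_image ?G parabola_pt \<gamma>))"
    if v: "v \<in> V" for v
  proof -
    let ?S = "drawing_image ?G parabola_pt \<gamma>"
    have chord: "(Re z)\<^sup>2 \<le> Im z" if "(u, w) \<in> E" "z \<in> path_image (\<gamma> (u, w))" for u w z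
      using that E[OF that(1)] by (auto simp: \<gamma>_def intro: chord_above_parabola)
    have above: "(Re z)\<^sup>2 \<le> Im z" if "z \<in> ?S" for z
      using that chord by (auto simp: drawing_image_def parabola_pt_def rev)
    define q where "q = (\<lambda>n::nat. parabola_pt v - \<i> * of_real (inverse (real (Suc n))))"
    have "q n \<in> outside ?S" for n
      by (intro below_parabola_outside above) (auto simp: q_def parabola_pt_def)
    moreover have "q \<longlonglongrightarrow> parabola_pt v - \<i> * of_real 0"
      unfolding q_def by (intro tendsto_intros LIMSEQ_inverse_real_of_nat)
    ultimately have "parabola_pt v \<in> closure (outside ?S)"
      unfolding closure_sequential by (intro exI[of _ q]) auto
    moreover have "parabola_pt v \<in> ?S" using v by (simp add: drawing_image_def)
    then have "parabola_pt v \<notin> outside ?S" by (simp add: outside_def)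
    then have "parabola_pt v \<notin> interior (outside ?S)" using interior_subset by blast
    ultimately show ?thesis by (simp add: frontier_def)
  qed
  ultimately show ?thesis unfolding outerplanar_def by auto
qed

subsection \<open>Zombie moves and open-loop survivors\<close>

lemma (in pair_wf_digraph) awalk_length_ge:
  assumes "\<And>u w. (u, w) \<in> parcs G \<Longrightarrow> f u \<le> Suc (f w)" "f s = 0" "awalk u p s"
  shows "f u \<le> length p"
  using assms(3)
proof (induction p arbitrary: u)
  case (Cons e p)
  then have "e \<in> parcs G" "u = fst e" "awalk (snd e) p s" by (auto simp: awalk_Cons_iff)
  then show ?case using Cons.IH[of "snd e"] assms(1)[of "fst e" "snd e"] by simp
qed (use assms in \<open>auto simp: awalk_Nil_iff\<close>)

text \<open>Arcs that lower \<open>f\<close> lead to \<open>s\<close>. The bound on \<open>f\<close>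
  along the path is carried through the induction because it shows that \<open>u\<close> does not
  recur.\<close>

lemma (in pair_wf_digraph) ex_descending_apath:
  assumes "\<And>u. u \<in> pverts G \<Longrightarrow> u \<noteq> s \<Longrightarrow> \<exists>w. (u, w) \<in> parcs G \<and> f w < f u" "u \<in> pverts G"
  shows "\<exists>p. apath u p s \<and> length p \<le> f u \<and> (\<forall>x\<in>set (pawalk_verts u p). f x \<le> (f u :: nat))"
  using assms(2)
proof (induction "f u" arbitrary: u rule: less_induct)
  case less
  show ?case
  proof (cases "u = s")
    case True
    then show ?thesis using less.prems by (intro exI[of _ "[]"]) (auto simp: apath_Nil_iff)
  next
    case False
    then obtain w where w: "(u, w) \<in> parcs G" "f w < f u" using assms(1) less.prems by blast
    then obtain p where p: "apath w p s" "length p \<le> f w" "\<forall>x\<in>set (pawalk_verts w p). f x \<le> f w"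
      using less.hyps[of w] in_arcsD2 by blast
    then show ?thesis
      using w by (intro exI[of _ "(u, w) # p"]) (auto simp: apath_Cons_iff)
  qed
qed

text \<open>The hypotheses say that \<open>f\<close> is the distance to \<open>s\<close>.\<close>

lemma (in pair_graph) zombie_move_decreases:
  fixes f :: "'a \<Rightarrow> nat"
  assumes move: "zombie_move G s u w" and "f s = 0"
    and lip: "\<And>u w. (u, w) \<in> parcs G \<Longrightarrow> f u \<le> Suc (f w)"
    and desc: "\<And>u. u \<in> pverts G \<Longrightarrow> u \<noteq> s \<Longrightarrow> \<exists>w. (u, w) \<in> parcs G \<and> f w < f u"
  shows "f w < f u"
proof -
  obtain p where uw: "(u, w) \<in> parcs G" and p: "shortest_path G u p s"
    and w: "w \<in> set (pawalk_verts u p)"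
    using move by (auto simp: zombie_move_def)
  then have u: "u \<in> pverts G" "u \<noteq> w" by (auto dest: in_arcsD1 no_loops')
  obtain q where "apath u q s" "length q \<le> f u"
    using ex_descending_apath[of s f u] desc u by blast
  then have len: "length p \<le> f u" and "apath u p s"
    using p unfolding shortest_path_def by (auto intro: order_trans)
  then have "awalk u p s" by (simp add: apath_def)
  \<comment> \<open>\<open>zombie_move\<close> only places \<open>w\<close> somewhere on a shortest
    path; being different from \<open>u\<close>, it still leaves a strictly shorter remainder
    \<open>p2\<close>.\<close>
  then obtain p1 p2 where "p = p1 @ p2" "awalk u p1 w" "awalk w p2 s"
    using awalk_decomp w by blast
  moreover then have "p1 \<noteq> []" using u by (auto simp: awalk_Nil_iff)
  moreover have "f w \<le> length p2"
    using awalk_length_ge[of f s w p2] lip assms(2) \<open>awalk w p2 s\<close> by blast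
  ultimately have "f w < length p" by (cases p1) auto
  then show ?thesis using len by simp
qed

text \<open>
  The survivor follows the orbit of \<open>nx\<close> without looking at the zombies. Hence the invariant \<open>I\<close>
  concerns one zombie at a time.
\<close>

definition safe_walk ::
  "'a pair_pre_digraph \<Rightarrow> ('a \<Rightarrow> 'a) \<Rightarrow> ('a \<Rightarrow> bool) \<Rightarrow> ('a \<Rightarrow> 'a \<Rightarrow> bool) \<Rightarrow> bool" where
  "safe_walk G nx S I \<longleftrightarrow>
     (\<forall>s. S s \<longrightarrow> s \<in> pverts G \<and> survivor_move G s (nx s) \<and> S (nx s)) \<and>
     (\<forall>s z. S s \<and> I s z \<longrightarrow> z \<noteq> s) \<and>
     (\<forall>s z w. S s \<and> I s z \<and> zombie_move G s z w \<longrightarrow> w \<noteq> s \<and> I (nx s) w)"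

text \<open>The two clauses of \<open>safe_walk\<close> on zombies match the two moments of capture:
  after the zombies' move and after the survivor's move.\<close>

lemma safe_walk_not_captured:
  assumes sw: "safe_walk G nx S I" and S: "S s\<^sub>0" and I: "\<And>z. z \<in> set (Z 0) \<Longrightarrow> I s\<^sub>0 z"
    and mv: "\<And>n. n < N \<Longrightarrow> zombies_move G ((nx ^^ n) s\<^sub>0) (Z n) (Z (Suc n))"
  shows "\<not> captured_in_round Z (\<lambda>n. (nx ^^ n) s\<^sub>0) N"
proof -
  have Sn: "S ((nx ^^ n) s\<^sub>0)" for n
    using S sw by (induction n) (auto simp: safe_walk_def)
  have step: "w \<noteq> (nx ^^ n) s\<^sub>0 \<and> I ((nx ^^ Suc n) s\<^sub>0) w"
    if In: "\<And>z. z \<in> set (Z n) \<Longrightarrow> I ((nx ^^ n) s\<^sub>0) z" 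
      and nN: "n < N" and wZ: "w \<in> set (Z (Suc n))" for n w
  proof -
    obtain z where "z \<in> set (Z n)" "zombie_move G ((nx ^^ n) s\<^sub>0) z w"
      using mv[OF nN] wZ
      unfolding zombies_move_def list_all2_conv_all_nth in_set_conv_nth by metis
    then show ?thesis
      using In Sn[of n] sw unfolding safe_walk_def funpow.simps comp_def by blast
  qed
  have In: "z \<in> set (Z n) \<Longrightarrow> I ((nx ^^ n) s\<^sub>0) z" if "n \<le> N" for n z
    using that
  proof (induction n arbitrary: z)
    case (Suc n)
    then show ?case using step[of n z] by simp
  qed (use I in simp)
  have "(nx ^^ N) s\<^sub>0 \<notin> set (Z N)"
    using In[OF order_refl] Sn[of N] sw unfolding safe_walk_def by metis
  moreover have "(nx ^^ (N - 1)) s\<^sub>0 \<notin> set (Z N)" if "N > 0"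
    using step[of "N - 1" "(nx ^^ (N - 1)) s\<^sub>0"] In[of "N - 1"] that by auto
  ultimately show ?thesis by (auto simp: captured_in_round_def)
qed

lemma safe_walk_survivor_move:
  assumes "safe_walk G nx S I" "S s\<^sub>0"
  shows "(nx ^^ n) s\<^sub>0 \<in> pverts G" "survivor_move G ((nx ^^ n) s\<^sub>0) ((nx ^^ Suc n) s\<^sub>0)"
proof -
  have "S ((nx ^^ n) s\<^sub>0)"
    using assms by (induction n) (auto simp: safe_walk_def)
  then show "(nx ^^ n) s\<^sub>0 \<in> pverts G" "survivor_move G ((nx ^^ n) s\<^sub>0) ((nx ^^ Suc n) s\<^sub>0)"
    using assms by (auto simp: safe_walk_def)
qed

text \<open>The history in round n has n + 1 entries, and the strategy reads only its
  length.\<close>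

lemma safe_walk_survivor_wins:
  assumes "safe_walk G nx S I" "S s\<^sub>0" "\<And>z. z \<in> set Z\<^sub>0 \<Longrightarrow> I s\<^sub>0 z"
  shows "survivor_winning_strategy G Z\<^sub>0 (\<lambda>h. (nx ^^ (length h - 1)) s\<^sub>0)"
  using safe_walk_not_captured[OF assms(1,2)] safe_walk_survivor_move[OF assms(1,2)]
    safe_walk_survivor_move(1)[OF assms(1,2), of 0] assms(3)
  unfolding survivor_winning_strategy_def Let_def
  by (auto simp del: funpow.simps upt_Suc)

text \<open>The walk is fixed in advance, so any zombie strategy can be played out against it; legal
  moves up to the alleged capture contradict the invariant.\<close>

lemma safe_walk_zombies_lose:
  assumes "safe_walk G nx S I" "S s\<^sub>0" "\<And>z. z \<in> set (\<tau> []) \<Longrightarrow> I s\<^sub>0 z"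
  shows "\<not> zombies_winning_strategy G m \<tau>"
proof
  let ?s = "\<lambda>n. (nx ^^ n) s\<^sub>0" and ?Z = "\<lambda>n. \<tau> (map (\<lambda>n. (nx ^^ n) s\<^sub>0) [0..<n])"
  assume "zombies_winning_strategy G m \<tau>"
  moreover have "?s 0 \<in> pverts G" "\<forall>n. survivor_move G (?s n) (?s (Suc n))"
    using safe_walk_survivor_move[OF assms(1,2)] by blast+
  ultimately obtain N where
    "\<And>n. n < N \<Longrightarrow> zombies_move G (?s n) (?Z n) (?Z (Suc n))" "captured_in_round ?Z ?s N"
    unfolding zombies_winning_strategy_def Let_def by (auto dest!: spec[of _ ?s])
  then show False
    using safe_walk_not_captured[OF assms(1,2), of ?Z N] assms(3) by simp
qed

text \<open>\<open>LEAST\<close> is informative only if some number of zombies wins: one zombie on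
  every vertex captures in round 0.\<close>

lemma zombie_number_ge:
  assumes "finite (pverts G)" "\<And>m \<tau>. zombies_winning_strategy G m \<tau> \<Longrightarrow> k \<le> m"
  shows "k \<le> zombie_number G"
proof -
  obtain Z where Z: "set Z = pverts G" using assms(1) finite_list by blast
  then have "zombies_winning_strategy G (length Z) (\<lambda>_. Z)"
    unfolding zombies_winning_strategy_def Let_def
    by (auto simp: placement_def captured_in_round_def intro!: exI[of _ 0])
  then have "\<exists>m \<tau>. zombies_winning_strategy G m \<tau>" by blast
  then have "\<exists>\<tau>. zombies_winning_strategy G (zombie_number G) \<tau>"
    unfolding zombie_number_def by (rule LeastI_ex)
  then show ?thesis using assms(2) by blast
qed

subsection \<open>Distances and pursuit in a gadget\<close>

text \<open>
  A gadget is a cycle \<open>0, 1, \<dots>, 8m - 1\<close> with the chord from \<open>3m\<close> to \<open>7m\<close>; it is glued to the rest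
  of the graph at \<open>0\<close>. Integer coordinates avoid truncated subtraction.
\<close>

definition gadget_edge :: "int \<Rightarrow> int \<Rightarrow> int \<Rightarrow> bool" where
  "gadget_edge m x y \<longleftrightarrow> 0 \<le> x \<and> x < y \<and> y < 8 * m \<and>
     (y = x + 1 \<or> (x = 0 \<and> y = 8 * m - 1) \<or> (x = 3 * m \<and> y = 7 * m))"

abbreviation gadget_adj :: "int \<Rightarrow> int \<Rightarrow> int \<Rightarrow> bool" where
  "gadget_adj m x y \<equiv> gadget_edge m x y \<or> gadget_edge m y x"

text \<open>
  The distance to \<open>s \<in> {1..7m}\<close>. The chord splits the gadget into two cycles of length \<open>4m + 1\<close>. On
  the cycle of \<open>s\<close> this is the cyclic distance; from the other cycle one passes through \<open>3m\<close> or \<open>7m\<close>.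
\<close>

definition gadget_dist :: "int \<Rightarrow> int \<Rightarrow> int \<Rightarrow> int" where
  "gadget_dist m s x =
    (if s \<le> 3 * m then
       if x \<le> 3 * m then min \<bar>x - s\<bar> (4 * m + 1 - \<bar>x - s\<bar>)
       else if x < 7 * m then
         min (x - 3 * m + min (3 * m - s) (s + m + 1)) (7 * m - x + min (3 * m + 1 - s) (s + m))
       else min (x + 1 - 4 * m - s) (8 * m + s - x)
     else
       if x < 3 * m then
         min (3 * m - x + min (s - 3 * m) (7 * m + 1 - s)) (x + m + min (7 * m - s) (s + 1 - 3 * m))
       else if x \<le> 7 * m then min \<bar>x - s\<bar> (4 * m + 1 - \<bar>x - s\<bar>)
       else min (11 * m - x + min (s - 3 * m) (7 * m + 1 - s))
              (x - 7 * m + min (7 * m - s) (s + 1 - 3 * m)))"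

lemma gadget_dist_self: "0 < m \<Longrightarrow> s \<le> 7 * m \<Longrightarrow> gadget_dist m s s = 0"
  by (simp add: gadget_dist_def)

lemma gadget_dist_nonneg:
  assumes "0 < m" "1 \<le> s" "s \<le> 7 * m" "0 \<le> x" "x < 8 * m"
  shows "0 \<le> gadget_dist m s x"
  using assms by (cases "s \<le> 3 * m") (auto simp: gadget_dist_def abs_if min_def)

lemma gadget_dist_step:
  assumes "0 < m" "1 \<le> s" "s \<le> 7 * m" "0 \<le> x" "x + 1 < 8 * m"
  shows "\<bar>gadget_dist m s x - gadget_dist m s (x + 1)\<bar> \<le> 1"
proof (cases "s \<le> 3 * m")
  case True
  consider "x < 3 * m" | "x = 3 * m" | "3 * m < x" "x + 1 < 7 * m" | "x + 1 = 7 * m" | "7 * m \<le> x"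
    by linarith
  then show ?thesis
    by cases (use True assms in \<open>auto simp: gadget_dist_def abs_if min_def\<close>)
next
  case False
  consider "x + 1 < 3 * m" | "x + 1 = 3 * m" | "3 * m \<le> x" "x < 7 * m" | "x = 7 * m" | "7 * m < x"
    by linarith
  then show ?thesis
    by cases (use False assms in \<open>auto simp: gadget_dist_def abs_if min_def\<close>)
qed

lemma gadget_dist_lipschitz:
  assumes "0 < m" "1 \<le> s" "s \<le> 7 * m" "gadget_edge m x y"
  shows "\<bar>gadget_dist m s x - gadget_dist m s y\<bar> \<le> 1"
proof -
  have "\<bar>gadget_dist m s 0 - gadget_dist m s (8 * m - 1)\<bar> \<le> 1"
    using assms by (cases "s \<le> 3 * m") (auto simp: gadget_dist_def abs_if min_def)
  moreover have "\<bar>gadget_dist m s (3 * m) - gadget_dist m s (7 * m)\<bar> \<le> 1"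
    using assms by (cases "s \<le> 3 * m") (auto simp: gadget_dist_def abs_if min_def)
  ultimately show ?thesis
    using assms gadget_dist_step[of m s x] by (auto simp: gadget_edge_def)
qed

text \<open>With \<open>gadget_dist_self\<close> and \<open>gadget_dist_lipschitz\<close> this
  certifies the formula as the distance without exhibiting shortest paths, in the form that
  \<open>zombie_move_decreases\<close> needs.\<close>

lemma gadget_dist_descent:
  assumes "0 < m" "1 \<le> s" "s \<le> 7 * m" "0 \<le> x" "x < 8 * m" "x \<noteq> s"
  shows "\<exists>y. gadget_adj m x y \<and> gadget_dist m s y < gadget_dist m s x"
proof -
  have "(x + 1 < 8 * m \<and> gadget_dist m s (x + 1) < gadget_dist m s x) \<or>
       (0 < x \<and> gadget_dist m s (x - 1) < gadget_dist m s x) \<or>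
       (x = 0 \<and> gadget_dist m s (8 * m - 1) < gadget_dist m s x) \<or>
       (x = 8 * m - 1 \<and> gadget_dist m s 0 < gadget_dist m s x) \<or>
       (x = 3 * m \<and> gadget_dist m s (7 * m) < gadget_dist m s x) \<or>
       (x = 7 * m \<and> gadget_dist m s (3 * m) < gadget_dist m s x)"
  proof (cases "s \<le> 3 * m")
    case True
    consider "x \<le> 3 * m" | "3 * m < x" "x < 7 * m" | "7 * m \<le> x" by linarith
    then show ?thesis
      by cases (use True assms in \<open>auto simp: gadget_dist_def abs_if min_def\<close>)
  next
    case False
    consider "x < 3 * m" | "3 * m \<le> x" "x \<le> 7 * m" | "7 * m < x" by linarith
    then show ?thesis
      by cases (use False assms in \<open>auto simp: gadget_dist_def abs_if min_def\<close>)
  qed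
  then show ?thesis
    by (elim disjE conjE)
      (use assms in \<open>auto simp: gadget_edge_def intro: exI[of _ "x + 1"] exI[of _ "x - 1"]
         exI[of _ "7 * m"] exI[of _ "3 * m"] exI[of _ "0"] exI[of _ "8 * m - 1"]\<close>)
qed

text \<open>
  The survivor runs \<open>1, 2, \<dots>, 7m\<close> and then forever around the cycle \<open>3m, \<dots>, 7m\<close>. A zombie trails
  her if she is ahead by between \<open>2\<close> and \<open>2m\<close> steps of this run, that is by less than half of
  either cycle, so that the zombie has to run after her; the second alternative is that she has
  crossed the chord and the zombie has not.
\<close>

definition lap_step :: "int \<Rightarrow> int \<Rightarrow> int" where
  "lap_step m x = (if x = 7 * m then 3 * m else x + 1)"

definition trails :: "int \<Rightarrow> int \<Rightarrow> int \<Rightarrow> bool" where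
  "trails m s z \<longleftrightarrow> 0 \<le> z \<and> z \<le> 7 * m \<and> s \<le> 7 * m \<and>
     ((z + 2 \<le> s \<and> s \<le> z + 2 * m) \<or>
      (3 * m \<le> s \<and> z + 2 \<le> s + 4 * m + 1 \<and> s + 4 * m + 1 \<le> z + 2 * m))"

lemma trails_descent:
  assumes "2 \<le> m" "1 \<le> s" "trails m s z" "gadget_adj m z y"
    "gadget_dist m s y < gadget_dist m s z"
  shows "y = lap_step m z"
proof (cases "s \<le> 3 * m")
  case True
  then show ?thesis
    using assms by (auto simp: trails_def gadget_edge_def lap_step_def gadget_dist_def abs_if min_def
        split: if_splits)
next
  case False
  then show ?thesis
    using assms by (auto simp: trails_def gadget_edge_def lap_step_def gadget_dist_def abs_if min_def
        split: if_splits)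
qed

text \<open>
  A zombie that enters the gadget too late to trail the survivor goes the other way round, from
  \<open>8m - 1\<close> down to \<open>7m\<close>. It gets there after she has passed \<open>3m\<close> and then trails her.
\<close>

definition opposes :: "int \<Rightarrow> int \<Rightarrow> int \<Rightarrow> bool" where
  "opposes m s z \<longleftrightarrow>
     (z = 0 \<and> 2 * m + 1 \<le> s \<and> s \<le> 4 * m - 1) \<or>
     (7 * m < z \<and> z < 8 * m \<and> 10 * m + 1 \<le> z + s \<and> z + s \<le> 12 * m - 1)"

text \<open>From 0 the way through 1 takes at least 2m + 1 steps, the way over 7m and the chord at
  most 2m. Further down, the way through z - 1 stays the shorter one.\<close>

lemma opposes_descent:
  assumes "2 \<le> m" "opposes m s z" "gadget_adj m z y"
    "gadget_dist m s y < gadget_dist m s z"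
  shows "y = (if z = 0 then 8 * m - 1 else z - 1)"
proof (cases "s \<le> 3 * m")
  case True
  then show ?thesis
    using assms by (auto simp: opposes_def gadget_edge_def gadget_dist_def abs_if min_def
        split: if_splits)
next
  case False
  then show ?thesis
    using assms by (auto simp: opposes_def gadget_edge_def gadget_dist_def abs_if min_def
        split: if_splits)
qed

text \<open>Both advance one step along the run, so the lead is constant; a lead of 2 keeps her free
  when the zombie moves first. Her jump from 7m to 3m makes her coordinate fall 4m + 1 short of the
  count, whence the second alternative of \<open>trails\<close>.\<close>

lemma trails_step:
  assumes "2 \<le> m" "1 \<le> s" "trails m s z"
  shows "lap_step m z \<noteq> s \<and> trails m (lap_step m s) (lap_step m z)"
  using assms by (auto simp: trails_def lap_step_def split: if_splits)

text \<open>With 0 counted as 8m, z + s is constant, since the zombie goes down as she goes up. At z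
  = 7m the bounds 10m + 1 and 12m - 1 read 3m + 1 \<le> s \<le> 5m - 1, the second alternative of
  \<open>trails\<close>.\<close>

lemma opposes_step:
  assumes "2 \<le> m" "opposes m s z" "z' = (if z = 0 then 8 * m - 1 else z - 1)"
  shows "z' \<noteq> s \<and> (opposes m (lap_step m s) z' \<or> trails m (lap_step m s) z')"
  using assms by (auto simp: trails_def opposes_def lap_step_def split: if_splits)

text \<open>She moves on to s + 1 while the zombie stands at 0: up to 2m it trails her, from 2m + 1
  to 4m - 1 it opposes her.\<close>

lemma enter_step:
  assumes "2 \<le> m" "1 \<le> s" "s \<le> 4 * m - 2"
  shows "opposes m (lap_step m s) 0 \<or> trails m (lap_step m s) 0"
  using assms by (auto simp: trails_def opposes_def lap_step_def split: if_splits)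

section \<open>Distance to the attaching vertex\<close>

definition walk_dist :: "'a rel \<Rightarrow> 'a \<Rightarrow> 'a \<Rightarrow> nat" where
  "walk_dist A r u = (LEAST n. (u, r) \<in> A ^^ n)"

lemma walk_dist_le: "(u, r) \<in> A ^^ n \<Longrightarrow> walk_dist A r u \<le> n"
  unfolding walk_dist_def by (rule Least_le)

lemma walk_dist_self: "walk_dist A r r = 0"
  using walk_dist_le[where n = 0 and u = r and r = r and A = A] by simp

lemma walk_dist_walk: "(u, r) \<in> A\<^sup>* \<Longrightarrow> (u, r) \<in> A ^^ walk_dist A r u"
  unfolding walk_dist_def by (rule LeastI_ex) (simp add: rtrancl_power)

lemma walk_dist_lipschitz:
  assumes "(u, w) \<in> A" "(w, r) \<in> A\<^sup>*"
  shows "walk_dist A r u \<le> Suc (walk_dist A r w)"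
  using walk_dist_walk[OF assms(2)] assms(1) by (intro walk_dist_le relpow_Suc_I2)

lemma walk_dist_descent:
  assumes "(u, r) \<in> A\<^sup>*" "u \<noteq> r"
  obtains w where "(u, w) \<in> A" "walk_dist A r w < walk_dist A r u"
proof (cases "walk_dist A r u")
  case 0
  then show ?thesis using walk_dist_walk[OF assms(1)] assms(2) by simp
next
  case (Suc n)
  then obtain w where "(u, w) \<in> A" "(w, r) \<in> A ^^ n"
    using walk_dist_walk[OF assms(1)] relpow_Suc_E2[of u r n A] by auto
  then show ?thesis using that[of w] walk_dist_le[OF \<open>(w, r) \<in> A ^^ n\<close>] Suc by auto
qed

text \<open>The pursuit is kept apart from the tree: it needs only that the gadget is joined to the
  rest of the graph through \<open>r\<close> and that every vertex reaches \<open>r\<close>.\<close>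

locale gadget_in_graph = pair_graph G for G :: "nat pair_pre_digraph" +
  fixes m r :: nat
  assumes m_ge_2: "2 \<le> m"
    and gadget_subset: "{r..<r + 8 * m} \<subseteq> pverts G"
    and gadget_arcs: "u \<in> {r..<r + 8 * m} \<Longrightarrow> w \<in> {r..<r + 8 * m} \<Longrightarrow>
      (u, w) \<in> parcs G \<longleftrightarrow> gadget_adj (int m) (int u - int r) (int w - int r)"
    and gadget_exit: "(u, w) \<in> parcs G \<Longrightarrow> u \<in> {r..<r + 8 * m} \<Longrightarrow> w \<notin> {r..<r + 8 * m} \<Longrightarrow> u = r"
    and walk_to_r: "u \<in> pverts G \<Longrightarrow> (u, r) \<in> (parcs G)\<^sup>*"
begin

abbreviation gadget :: "nat set" where "gadget \<equiv> {r..<r + 8 * m}"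

abbreviation coord :: "nat \<Rightarrow> int" where "coord u \<equiv> int u - int r"

text \<open>From outside, every walk to a vertex \<open>s\<close> of the gadget passes through
  \<open>r\<close>, which has coordinate 0, so two distances add up.\<close>

definition dist_to :: "nat \<Rightarrow> nat \<Rightarrow> nat" where
  "dist_to s u =
    (if u \<in> gadget then nat (gadget_dist (int m) (coord s) (coord u))
     else walk_dist (parcs G) r u + nat (gadget_dist (int m) (coord s) 0))"

lemma arcs_sym: "(u, w) \<in> parcs G \<Longrightarrow> (w, u) \<in> parcs G"
  using pair_sym_arcs by (auto simp: symmetric_def dest: symD)

text \<open>An instance of \<open>zombie_move_decreases\<close>: an arc across the boundary of the
  gadget has \<open>r\<close> as its inner end, where both branches of \<open>dist_to\<close> would
  agree.\<close>

lemma zombie_move_dist_to: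
  assumes s: "r + 1 \<le> s" "s \<le> r + 7 * m" and mv: "zombie_move G s u w"
  shows "dist_to s w < dist_to s u"
proof (rule zombie_move_decreases[OF mv])
  have m: "0 < int m" "1 \<le> coord s" "coord s \<le> 7 * int m" using s m_ge_2 by auto
  let ?d = "gadget_dist (int m) (coord s)" and ?D = "walk_dist (parcs G) r"
  have d0: "0 \<le> ?d (coord u)" if "u \<in> gadget" for u
    using that by (intro gadget_dist_nonneg[OF m]) auto
  show "dist_to s s = 0"
    using s m by (simp add: dist_to_def gadget_dist_self)
  have exit: "u = r" if "(w, u) \<in> parcs G" "u \<in> gadget" "w \<notin> gadget" for u w
    using gadget_exit arcs_sym that by blast
  show "dist_to s u \<le> Suc (dist_to s w)" if a: "(u, w) \<in> parcs G" for u w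
  proof -
    have D: "?D u \<le> Suc (?D w)"
      using a by (intro walk_dist_lipschitz walk_to_r in_arcsD2)
    consider "u \<in> gadget" "w \<in> gadget" | "u = r" "w \<notin> gadget" | "w = r" "u \<notin> gadget"
      | "u \<notin> gadget" "w \<notin> gadget"
      using a gadget_exit[of u w] exit[of u w] by blast
    then show ?thesis
    proof cases
      case 1
      then have "\<bar>?d (coord u) - ?d (coord w)\<bar> \<le> 1"
        using a gadget_arcs[OF 1] gadget_dist_lipschitz[OF m, of "coord u" "coord w"]
          gadget_dist_lipschitz[OF m, of "coord w" "coord u"] by (auto simp: abs_minus_commute)
      then show ?thesis using 1 d0 by (auto simp: dist_to_def)
    next
      case 3
      then show ?thesis using D m_ge_2 by (auto simp: dist_to_def walk_dist_self)
    qed (use D in \<open>auto simp: dist_to_def\<close>)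
  qed
  show "\<exists>w. (u, w) \<in> parcs G \<and> dist_to s w < dist_to s u" if u: "u \<in> pverts G" "u \<noteq> s" for u
  proof (cases "u \<in> gadget")
    case True
    then have "0 \<le> coord u" "coord u < 8 * int m" "coord u \<noteq> coord s" using u by auto
    then obtain y where y: "gadget_adj (int m) (coord u) y" "?d y < ?d (coord u)"
      using gadget_dist_descent[OF m] by blast
    define w where "w = nat (int r + y)"
    have "0 \<le> y" "y < 8 * int m" using y(1) by (auto simp: gadget_edge_def)
    then have w: "w \<in> gadget" "coord w = y" by (auto simp: w_def)
    then show ?thesis
      using True y gadget_arcs[OF True w(1)] d0[OF w(1)] by (intro exI[of _ w]) (auto simp: dist_to_def)
  next
    case False
    then have "u \<noteq> r" using m_ge_2 by auto
    then obtain w where w: "(u, w) \<in> parcs G" "?D w < ?D u"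
      using walk_dist_descent[OF walk_to_r[OF u(1)]] by blast
    then show ?thesis
      using False exit[of u w] by (intro exI[of _ w]) (auto simp: dist_to_def)
  qed
qed

definition run :: "nat \<Rightarrow> nat" where
  "run s = (if s = r + 7 * m then r + 3 * m else Suc s)"

text \<open>Outside, the zombie's distance to \<open>r\<close> falls in each round while her
  coordinate grows by one, so the sum stays at most 4m - 1. Just before entry the distance is at
  least 1, which gives the bound s \<le> 4m - 2 of \<open>enter_step\<close>.\<close>

definition harmless :: "nat \<Rightarrow> nat \<Rightarrow> bool" where
  "harmless s z \<longleftrightarrow> z \<in> pverts G \<and>
    (if z \<in> gadget then opposes (int m) (coord s) (coord z) \<or> trails (int m) (coord s) (coord z)
     else int (walk_dist (parcs G) r z) + coord s \<le> 4 * int m - 1)"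

lemma harmless_step:
  assumes s: "r + 1 \<le> s" "s \<le> r + 7 * m" and h: "harmless s z" and mv: "zombie_move G s z w"
  shows "w \<noteq> s \<and> harmless (run s) w"
proof -
  have m: "2 \<le> int m" "1 \<le> coord s" using m_ge_2 s by auto
  have dec: "dist_to s w < dist_to s z" by (rule zombie_move_dist_to[OF s mv])
  have zw: "(z, w) \<in> parcs G" using mv by (simp add: zombie_move_def)
  then have w: "w \<in> pverts G" by (rule in_arcsD2)
  have run: "coord (run s) = lap_step (int m) (coord s)" by (auto simp: run_def lap_step_def)
  have sH: "s \<in> gadget" using s m_ge_2 by auto
  show ?thesis
  proof (cases "z \<in> gadget")
    case z: True
    \<comment> \<open>A zombie cannot leave the gadget: it would exit through \<open>r\<close> and
      increase its distance.\<close>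
    have wH: "w \<in> gadget"
    proof (rule ccontr)
      assume "w \<notin> gadget"
      moreover then have "z = r" using gadget_exit zw z by blast
      ultimately show False using dec z by (auto simp: dist_to_def split: if_splits)
    qed
    have adj: "gadget_adj (int m) (coord z) (coord w)" using gadget_arcs[OF z wH] zw by simp
    have lt: "gadget_dist (int m) (coord s) (coord w) < gadget_dist (int m) (coord s) (coord z)"
      using dec z wH by (auto simp: dist_to_def split: if_splits)
    have "coord w \<noteq> coord s \<and>
        (opposes (int m) (coord (run s)) (coord w) \<or> trails (int m) (coord (run s)) (coord w))"
    proof (cases "trails (int m) (coord s) (coord z)")
      case True
      then show ?thesis
        using trails_descent[OF m True adj lt] trails_step[OF m True] by (simp add: run)
    next
      case False
      then have o: "opposes (int m) (coord s) (coord z)" using h z by (simp add: harmless_def)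
      show ?thesis
        unfolding run by (rule opposes_step[OF m(1) o opposes_descent[OF m(1) o adj lt]])
    qed
    then show ?thesis using w wH by (auto simp: harmless_def)
  next
    case z: False
    let ?D = "walk_dist (parcs G) r"
    have b: "int (?D z) + coord s \<le> 4 * int m - 1"
      using h z unfolding harmless_def by presburger
    \<comment> \<open>She does not jump back to 3m while this zombie is outside, since s \<le> 4m -
      1 < 7m.\<close>
    have ls: "coord (run s) = coord s + 1"
      using b m by (auto simp: run lap_step_def)
    show ?thesis
    proof (cases "w \<in> gadget")
      case True
      then have "w = r" using gadget_exit arcs_sym zw z by blast
      have "?D z \<noteq> 0"
        using walk_dist_walk[OF walk_to_r[OF in_arcsD1[OF zw]]] z m_ge_2 by (auto intro!: Nat.gr0I)
      then have "opposes (int m) (coord (run s)) 0 \<or> trails (int m) (coord (run s)) 0"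
        using enter_step[OF m] b unfolding run by auto
      then show ?thesis using \<open>w = r\<close> s w m_ge_2 by (auto simp: harmless_def)
    next
      case False
      then have "?D w < ?D z" using dec z unfolding dist_to_def by presburger
      then show ?thesis using False sH b w ls by (auto simp: harmless_def)
    qed
  qed
qed

lemma safe_walk_run: "safe_walk G run (\<lambda>s. r + 1 \<le> s \<and> s \<le> r + 7 * m) harmless"
  unfolding safe_walk_def
proof (intro conjI allI impI; (elim conjE)?)
  fix s assume s: "r + 1 \<le> s" "s \<le> r + 7 * m"
  then have sH: "s \<in> gadget" and rH: "run s \<in> gadget" using m_ge_2 by (auto simp: run_def)
  then show "s \<in> pverts G" using gadget_subset by blast
  have "gadget_adj (int m) (coord s) (coord (run s))"
    using s m_ge_2 by (auto simp: run_def gadget_edge_def)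
  then show "survivor_move G s (run s)"
    using gadget_arcs[OF sH rH] by (simp add: survivor_move_def)
  show "r + 1 \<le> run s" "run s \<le> r + 7 * m" using s m_ge_2 by (auto simp: run_def)
next
  fix s z assume s: "r + 1 \<le> s" "s \<le> r + 7 * m" and "harmless s z"
  then show "z \<noteq> s" using m_ge_2 by (auto simp: harmless_def opposes_def trails_def)
next
  fix s z w assume "r + 1 \<le> s" "s \<le> r + 7 * m" "harmless s z" "zombie_move G s z w"
  then show "w \<noteq> s" "harmless (run s) w" using harmless_step by blast+
qed

text \<open>She starts at coordinate 1, so a distance of 4m - 2 just meets \<open>harmless\<close>.
  Zombie strategies are refuted separately because the two notions of winning are not defined as
  negations of each other.\<close>

lemma survivor_escapes:
  assumes "\<And>z. z \<in> set Z \<Longrightarrow> z \<in> pverts G \<and> z \<notin> gadget \<and> walk_dist (parcs G) r z \<le> 4 * m - 2"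
  shows "\<exists>\<sigma>. survivor_winning_strategy G Z \<sigma>"
    and "Z = \<tau> [] \<Longrightarrow> \<not> zombies_winning_strategy G l \<tau>"
proof -
  have h: "harmless (r + 1) z" if "z \<in> set Z" for z
    using assms[OF that] m_ge_2 by (auto simp: harmless_def)
  have s: "r + 1 \<le> r + 1 \<and> r + 1 \<le> r + 7 * m" using m_ge_2 by simp
  show "\<exists>\<sigma>. survivor_winning_strategy G Z \<sigma>"
    using safe_walk_survivor_wins[OF safe_walk_run s, of Z] h by blast
  show "\<not> zombies_winning_strategy G l \<tau>" if "Z = \<tau> []"
    using safe_walk_zombies_lose[OF safe_walk_run s, of \<tau> l] h that by simp
qed

end

subsection \<open>Binary trees of gadgets\<close>

text \<open>
  \<open>gadget_tree m l b n R E\<close>: a tree of depth at most \<open>l\<close> with root \<open>b\<close> and vertices \<open>{b..<b + n}\<close>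
  whose leaves \<open>R\<close> are the attaching vertices of gadgets. Each edge is listed once, smaller end first;
  the preorder numbering makes the edges noncrossing.
\<close>

inductive gadget_tree :: "nat \<Rightarrow> nat \<Rightarrow> nat \<Rightarrow> nat \<Rightarrow> nat set \<Rightarrow> nat rel \<Rightarrow> bool" for m where
  leaf: "gadget_tree m l b (8 * m) {b} {(u, v). gadget_edge (int m) (int u - int b) (int v - int b)}"
| node: "gadget_tree m l (b + 1) n\<^sub>1 R\<^sub>1 E\<^sub>1 \<Longrightarrow> gadget_tree m l (b + 1 + n\<^sub>1) n\<^sub>2 R\<^sub>2 E\<^sub>2 \<Longrightarrow>
    gadget_tree m (Suc l) b (1 + n\<^sub>1 + n\<^sub>2) (R\<^sub>1 \<union> R\<^sub>2) (E\<^sub>1 \<union> E\<^sub>2 \<union> {(b, b + 1), (b, b + 1 + n\<^sub>1)})"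

lemma gadget_tree_pos: "gadget_tree m l b n R E \<Longrightarrow> 0 < m \<Longrightarrow> 0 < n"
  by (induction rule: gadget_tree.induct) auto

lemma gadget_tree_edges:
  assumes "gadget_tree m l b n R E" "0 < m" "(u, v) \<in> E"
  shows "b \<le> u \<and> u < v \<and> v < b + n"
  using assms
proof (induction arbitrary: u v rule: gadget_tree.induct)
  case (node l b n\<^sub>1 R\<^sub>1 E\<^sub>1 n\<^sub>2 R\<^sub>2 E\<^sub>2)
  have "0 < n\<^sub>1" "0 < n\<^sub>2" using node.hyps node.prems(1) gadget_tree_pos by blast+
  then show ?case using node.IH[of u v] node.prems by auto
qed (auto simp: gadget_edge_def)

text \<open>In a crossing the second edge starts after u \<ge> b, so it is not an edge at the root.
  It lies in the interval of one subtree, and the crossing forces the first edge into the same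
  subtree.\<close>

lemma gadget_tree_noncrossing:
  assumes "gadget_tree m l b n R E" "0 < m" "(u, v) \<in> E" "(x, y) \<in> E"
  shows "\<not> (u < x \<and> x < v \<and> v < y)"
  using assms
proof (induction arbitrary: u v x y rule: gadget_tree.induct)
  case (node l b n\<^sub>1 R\<^sub>1 E\<^sub>1 n\<^sub>2 R\<^sub>2 E\<^sub>2)
  note e = gadget_tree_edges[OF node.hyps(1) node.prems(1)]
    gadget_tree_edges[OF node.hyps(2) node.prems(1)]
  show ?case
  proof
    assume c: "u < x \<and> x < v \<and> v < y"
    have "b < x" using node.prems(2) c e[of u v] by auto
    then have "(x, y) \<in> E\<^sub>1 \<union> E\<^sub>2" using node.prems(3) by auto
    then show False
    proof
      assume xy: "(x, y) \<in> E\<^sub>1"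
      then have "(u, v) \<in> E\<^sub>1" using e(1)[OF xy] e(2)[of u v] node.prems(2) c by auto
      then show False using node.IH(1)[OF node.prems(1) _ xy] c by blast
    next
      assume xy: "(x, y) \<in> E\<^sub>2"
      then have "(u, v) \<in> E\<^sub>2" using e(2)[OF xy] e(1)[of u v] node.prems(2) c by auto
      then show False using node.IH(2)[OF node.prems(1) _ xy] c by blast
    qed
  qed
qed (auto simp: gadget_edge_def)

lemma gadget_tree_roots:
  assumes "gadget_tree m l b n R E" "r \<in> R"
  shows "b \<le> r \<and> r + 8 * m \<le> b + n"
  using assms by (induction arbitrary: r rule: gadget_tree.induct) force+

text \<open>There are 8m vertices per gadget and one inner node fewer than gadgets.\<close>

lemma gadget_tree_card:
  assumes "gadget_tree m l b n R E" "0 < m"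
  shows "finite R \<and> card R * (8 * m + 1) = n + 1"
  using assms
proof (induction rule: gadget_tree.induct)
  case (node l b n\<^sub>1 R\<^sub>1 E\<^sub>1 n\<^sub>2 R\<^sub>2 E\<^sub>2)
  have "R\<^sub>1 \<inter> R\<^sub>2 = {}"
    using gadget_tree_roots[OF node.hyps(1)] gadget_tree_roots[OF node.hyps(2)] \<open>0 < m\<close> by force
  then show ?case using node by (simp add: card_Un_disjoint algebra_simps)
qed auto

lemma gadget_tree_disjoint:
  assumes "gadget_tree m l b n R E" "r \<in> R" "r' \<in> R" "r \<noteq> r'"
  shows "r + 8 * m \<le> r' \<or> r' + 8 * m \<le> r"
  using assms
proof (induction arbitrary: r r' rule: gadget_tree.induct)
  case (node l b n\<^sub>1 R\<^sub>1 E\<^sub>1 n\<^sub>2 R\<^sub>2 E\<^sub>2)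
  note e = gadget_tree_roots[OF node.hyps(1)] gadget_tree_roots[OF node.hyps(2)]
  show ?case using node.prems node.IH[of r r'] e[of r] e[of r'] by fastforce
qed auto

text \<open>These facts yield \<open>gadget_arcs\<close> and \<open>gadget_exit\<close>. An edge
  that starts in the interval of a subtree belongs to that subtree; as parents precede children, an
  edge joining a gadget to the outside comes from a smaller vertex and ends in
  \<open>r\<close>.\<close>

lemma gadget_tree_gadget:
  assumes "gadget_tree m l b n R E" "0 < m" "r \<in> R"
  shows "u \<in> {r..<r + 8 * m} \<Longrightarrow> v \<in> {r..<r + 8 * m} \<Longrightarrow>
      (u, v) \<in> E \<longleftrightarrow> gadget_edge (int m) (int u - int r) (int v - int r)"
    and "(u, v) \<in> E \<Longrightarrow> u \<in> {r..<r + 8 * m} \<Longrightarrow> v \<in> {r..<r + 8 * m}"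
    and "(u, v) \<in> E \<Longrightarrow> v \<in> {r..<r + 8 * m} \<Longrightarrow> u \<notin> {r..<r + 8 * m} \<Longrightarrow> v = r"
  using assms
proof (induction arbitrary: r u v rule: gadget_tree.induct)
  case (node l b n\<^sub>1 R\<^sub>1 E\<^sub>1 n\<^sub>2 R\<^sub>2 E\<^sub>2)
  note e1 = gadget_tree_edges[OF node.hyps(1) \<open>0 < m\<close>]
    and e2 = gadget_tree_edges[OF node.hyps(2) \<open>0 < m\<close>]
    and r1 = gadget_tree_roots[OF node.hyps(1)] and r2 = gadget_tree_roots[OF node.hyps(2)]
  have pos: "0 < n\<^sub>1" "0 < n\<^sub>2" using node.hyps \<open>0 < m\<close> gadget_tree_pos by blast+
  let ?E = "E\<^sub>1 \<union> E\<^sub>2 \<union> {(b, b + 1), (b, b + 1 + n\<^sub>1)}"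
  have sub: "r \<in> R\<^sub>1 \<Longrightarrow> {r..<r + 8 * m} \<subseteq> {b + 1..<b + 1 + n\<^sub>1}"
    "r \<in> R\<^sub>2 \<Longrightarrow> {r..<r + 8 * m} \<subseteq> {b + 1 + n\<^sub>1..<b + 1 + n\<^sub>1 + n\<^sub>2}" for r
    using r1[of r] r2[of r] by auto
  have E1: "(u, v) \<in> ?E \<longleftrightarrow> (u, v) \<in> E\<^sub>1" if "u \<in> {b + 1..<b + 1 + n\<^sub>1}" for u v
    using that e2[of u v] by auto
  have E2: "(u, v) \<in> ?E \<longleftrightarrow> (u, v) \<in> E\<^sub>2" if "u \<in> {b + 1 + n\<^sub>1..<b + 1 + n\<^sub>1 + n\<^sub>2}" for u v
    using that e1[of u v] by auto
  {
    case 1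
    from \<open>r \<in> R\<^sub>1 \<union> R\<^sub>2\<close> show ?case
    proof
      assume r: "r \<in> R\<^sub>1"
      show ?case
        unfolding E1[OF subsetD[OF sub(1)[OF r] 1(1)]] by (rule node.IH(1)[OF 1(1,2) \<open>0 < m\<close> r])
    next
      assume r: "r \<in> R\<^sub>2"
      show ?case
        unfolding E2[OF subsetD[OF sub(2)[OF r] 1(1)]] by (rule node.IH(4)[OF 1(1,2) \<open>0 < m\<close> r])
    qed
  next
    case 2
    from \<open>r \<in> R\<^sub>1 \<union> R\<^sub>2\<close> show ?case
    proof
      assume r: "r \<in> R\<^sub>1"
      have "(u, v) \<in> E\<^sub>1" using 2(1) unfolding E1[OF subsetD[OF sub(1)[OF r] 2(2)]] .
      then show ?case using node.IH(2)[OF _ 2(2) \<open>0 < m\<close> r] by simp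
    next
      assume r: "r \<in> R\<^sub>2"
      have "(u, v) \<in> E\<^sub>2" using 2(1) unfolding E2[OF subsetD[OF sub(2)[OF r] 2(2)]] .
      then show ?case using node.IH(5)[OF _ 2(2) \<open>0 < m\<close> r] by simp
    qed
  next
    case 3
    consider "(u, v) \<in> E\<^sub>1" | "(u, v) \<in> E\<^sub>2" | "u = b" "v = b + 1 \<or> v = b + 1 + n\<^sub>1"
      using \<open>(u, v) \<in> ?E\<close> by blast
    then show ?case
    proof cases
      case 1
      then have "r \<in> R\<^sub>1" using 3(2,5) e1[OF 1] r2[of r] by auto
      then show ?thesis using node.IH(3)[OF 1 3(2,3) \<open>0 < m\<close>] by simp
    next
      case 2
      then have "r \<in> R\<^sub>2" using 3(2,5) e2[OF 2] r1[of r] by auto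
      then show ?thesis using node.IH(6)[OF 2 3(2,3) \<open>0 < m\<close>] by simp
    next
      case 3
      then show ?thesis
        using \<open>v \<in> {r..<r + 8 * m}\<close> \<open>r \<in> R\<^sub>1 \<union> R\<^sub>2\<close> r1[of r] r2[of r] pos by auto
    qed
  }
qed (auto simp: gadget_edge_def)

text \<open>The induction keeps the root at two neighbours, which leaves room for its parent one
  level up.\<close>

lemma gadget_tree_degree:
  assumes "gadget_tree m l b n R E" "2 \<le> m"
  shows "(\<exists>x y. \<forall>w. (b, w) \<in> E \<union> E\<inverse> \<longrightarrow> w \<in> {x, y}) \<and>
    (\<forall>v. \<exists>x y z. \<forall>w. (v, w) \<in> E \<union> E\<inverse> \<longrightarrow> w \<in> {x, y, z})"
  using assms
proof (induction rule: gadget_tree.induct)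
  case (leaf l b)
  let ?E = "{(u, v). gadget_edge (int m) (int u - int b) (int v - int b)}"
  have "\<forall>w. (b, w) \<in> ?E \<union> ?E\<inverse> \<longrightarrow> w \<in> {b + 1, b + 8 * m - 1}"
    using leaf by (auto simp: gadget_edge_def)
  moreover have "\<exists>x y z. \<forall>w. (v, w) \<in> ?E \<union> ?E\<inverse> \<longrightarrow> w \<in> {x, y, z}" for v
  proof -
    \<comment> \<open>The candidate besides v - 1 and v + 1, from the closing edge or the chord; the
      last branch serves v = b + 8m - 1.\<close>
    define z where "z = (if v = b then b + 8 * m - 1 else if v = b + 3 * m then b + 7 * m
      else if v = b + 7 * m then b + 3 * m else b)"
    have "w \<in> {v - 1, v + 1, z}" if "(v, w) \<in> ?E \<union> ?E\<inverse>" for w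
      using that leaf by (auto simp: gadget_edge_def z_def)
    then show ?thesis by blast
  qed
  ultimately show ?case by blast
next
  case (node l b n\<^sub>1 R\<^sub>1 E\<^sub>1 n\<^sub>2 R\<^sub>2 E\<^sub>2)
  have "0 < m" using node.prems by simp
  note e1 = gadget_tree_edges[OF node.hyps(1) \<open>0 < m\<close>]
    and e2 = gadget_tree_edges[OF node.hyps(2) \<open>0 < m\<close>]
  have pos: "0 < n\<^sub>1" "0 < n\<^sub>2" using node.hyps \<open>0 < m\<close> gadget_tree_pos by blast+
  let ?E = "E\<^sub>1 \<union> E\<^sub>2 \<union> {(b, b + 1), (b, b + 1 + n\<^sub>1)}"
  have b: "w \<in> {b + 1, b + 1 + n\<^sub>1}" if "(b, w) \<in> ?E \<union> ?E\<inverse>" for w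
    using that e1[of b w] e1[of w b] e2[of b w] e2[of w b] by auto
  moreover have "\<exists>x y z. \<forall>w. (v, w) \<in> ?E \<union> ?E\<inverse> \<longrightarrow> w \<in> {x, y, z}" for v
  proof -
    consider "v = b" | "v = b + 1" | "v = b + 1 + n\<^sub>1" | "b + 1 < v" "v < b + 1 + n\<^sub>1"
      | "v < b \<or> b + 1 + n\<^sub>1 < v" by linarith
    then show ?thesis
    proof cases
      case 1 then show ?thesis using b by blast
    next
      case 2
      obtain x y where xy: "\<And>w. (v, w) \<in> E\<^sub>1 \<union> E\<^sub>1\<inverse> \<Longrightarrow> w \<in> {x, y}"
        using node.IH(1) node.prems 2 by blast
      have "w \<in> {x, y, b}" if "(v, w) \<in> ?E \<union> ?E\<inverse>" for w
        using that xy[of w] e2[of v w] e2[of w v] 2 pos by auto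
      then show ?thesis by blast
    next
      case 3
      obtain x y where xy: "\<And>w. (v, w) \<in> E\<^sub>2 \<union> E\<^sub>2\<inverse> \<Longrightarrow> w \<in> {x, y}"
        using node.IH(2) node.prems 3 by blast
      have "w \<in> {x, y, b}" if "(v, w) \<in> ?E \<union> ?E\<inverse>" for w
        using that xy[of w] e1[of v w] e1[of w v] 3 pos by auto
      then show ?thesis by blast
    next
      case 4
      have "(v, w) \<in> E\<^sub>1 \<union> E\<^sub>1\<inverse>" if "(v, w) \<in> ?E \<union> ?E\<inverse>" for w
        using that e2[of v w] e2[of w v] 4 by auto
      moreover obtain x y z where "\<forall>w. (v, w) \<in> E\<^sub>1 \<union> E\<^sub>1\<inverse> \<longrightarrow> w \<in> {x, y, z}"
        using node.IH(1) node.prems by blast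
      ultimately show ?thesis by blast
    next
      case 5
      have "(v, w) \<in> E\<^sub>2 \<union> E\<^sub>2\<inverse>" if "(v, w) \<in> ?E \<union> ?E\<inverse>" for w
        using that e1[of v w] e1[of w v] 5 by auto
      moreover obtain x y z where "\<forall>w. (v, w) \<in> E\<^sub>2 \<union> E\<^sub>2\<inverse> \<longrightarrow> w \<in> {x, y, z}"
        using node.IH(2) node.prems by blast
      ultimately show ?thesis by blast
    qed
  qed
  ultimately show ?case by blast
qed

section \<open>Short walks to the root\<close>

lemma relpow_trans: "(x, y) \<in> A ^^ i \<Longrightarrow> (y, z) \<in> A ^^ j \<Longrightarrow> (x, z) \<in> A ^^ (i + j)"
  by (auto simp: relpow_add)

lemma relpow_path:
  assumes "\<And>i. i < k \<Longrightarrow> (p i, p (Suc i)) \<in> A"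
  shows "(p 0, p k) \<in> A ^^ k"
  using assms by (induction k) auto

text \<open>Up to 3m walk down; from 5m on walk up and over the closing edge. In between go down to
  3m, cross the chord and continue up from 7m, in x - 2m + 1 \<le> 3m steps.\<close>

lemma gadget_walk_to_root:
  assumes "0 < m" "x < 8 * m"
    and A: "\<And>u v. gadget_adj (int m) (int u - int b) (int v - int b) \<Longrightarrow> (u, v) \<in> A"
  shows "\<exists>i\<le>3 * m. (b + x, b) \<in> A ^^ i"
proof -
  have down: "(b + y, b + y - j) \<in> A ^^ j" if "y < 8 * m" "j \<le> y" for y j
    using relpow_path[of j "\<lambda>i. b + y - i" A] that A by (auto simp: gadget_edge_def)
  have up: "(b + y, b + y + j) \<in> A ^^ j" if "y + j < 8 * m" for y j
    using relpow_path[of j "\<lambda>i. b + y + i" A] that A by (auto simp: gadget_edge_def)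
  have closing: "(b + 8 * m - 1, b) \<in> A" and across: "(b + 3 * m, b + 7 * m) \<in> A"
    using \<open>0 < m\<close> by (auto intro!: A simp: gadget_edge_def)
  have around: "(b + y, b) \<in> A ^^ (8 * m - y)" if "y < 8 * m" for y
  proof -
    have "(b + y, b + 8 * m - 1) \<in> A ^^ (8 * m - 1 - y)"
      using up[of y "8 * m - 1 - y"] that by simp
    then have "(b + y, b) \<in> A ^^ Suc (8 * m - 1 - y)" using closing by (rule relpow_Suc_I)
    moreover have "Suc (8 * m - 1 - y) = 8 * m - y" using that by simp
    ultimately show ?thesis by metis
  qed
  consider "x \<le> 3 * m" | "5 * m \<le> x" | "3 * m < x" "x < 5 * m" by linarith
  then show ?thesis
  proof cases
    case 1 then show ?thesis using down[of x x] assms by auto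
  next
    case 2 then show ?thesis using around[of x] assms by (intro exI[of _ "8 * m - x"]) auto
  next
    case 3
    have "(b + x, b + 3 * m) \<in> A ^^ (x - 3 * m)" using down[of x "x - 3 * m"] 3 assms by simp
    then have "(b + x, b + 7 * m) \<in> A ^^ Suc (x - 3 * m)" using across by (rule relpow_Suc_I)
    moreover have "(b + 7 * m, b) \<in> A ^^ m" using around[of "7 * m"] \<open>0 < m\<close> by simp
    ultimately have "(b + x, b) \<in> A ^^ (Suc (x - 3 * m) + m)" by (rule relpow_trans)
    then show ?thesis using 3 by (intro exI[of _ "Suc (x - 3 * m) + m"]) auto
  qed
qed

lemma relpow_mono:
  fixes A B :: "'a rel"
  assumes "(x, y) \<in> A ^^ i" "A \<subseteq> B"
  shows "(x, y) \<in> B ^^ i"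
  using assms(1)
proof (induction i arbitrary: y)
  case (Suc i)
  then obtain z where "(x, z) \<in> A ^^ i" "(z, y) \<in> A" by auto
  then show ?case using Suc.IH assms(2) by auto
qed simp

lemma relpow_le_extend:
  fixes A B :: "'a rel"
  assumes "\<exists>i\<le>d. (v, c) \<in> A ^^ i" "A \<subseteq> B" "(c, b) \<in> B"
  shows "\<exists>i\<le>Suc d. (v, b) \<in> B ^^ i"
proof -
  obtain i where "i \<le> d" "(v, c) \<in> A ^^ i" using assms(1) by blast
  then have "(v, b) \<in> B ^^ Suc i" "Suc i \<le> Suc d"
    using relpow_mono[OF _ assms(2)] assms(3) by auto
  then show ?thesis by (intro exI conjI)
qed

lemma gadget_tree_walks:
  assumes "gadget_tree m l b n R E" "0 < m"
  shows "u \<in> {b..<b + n} \<Longrightarrow> \<exists>i\<le>l + 3 * m. (u, b) \<in> (E \<union> E\<inverse>) ^^ i"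
    and "r \<in> R \<Longrightarrow> \<exists>i\<le>l. (r, b) \<in> (E \<union> E\<inverse>) ^^ i"
  using assms
proof (induction arbitrary: u r rule: gadget_tree.induct)
  case (leaf l b)
  let ?E = "{(u, v). gadget_edge (int m) (int u - int b) (int v - int b)}"
  {
    case 1
    then have u: "u - b < 8 * m" "b + (u - b) = u" by auto
    have "\<exists>i\<le>3 * m. (b + (u - b), b) \<in> (?E \<union> ?E\<inverse>) ^^ i"
      by (rule gadget_walk_to_root[OF \<open>0 < m\<close> u(1)]) simp
    then obtain i where "i \<le> 3 * m" "(u, b) \<in> (?E \<union> ?E\<inverse>) ^^ i" unfolding u(2) by blast
    moreover then have "i \<le> l + 3 * m" by simp
    ultimately show ?case by blast
  next
    case 2
    then show ?case by (intro exI[of _ 0]) simp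
  }
next
  case (node l b n\<^sub>1 R\<^sub>1 E\<^sub>1 n\<^sub>2 R\<^sub>2 E\<^sub>2)
  let ?E = "E\<^sub>1 \<union> E\<^sub>2 \<union> {(b, b + 1), (b, b + 1 + n\<^sub>1)}"
  have sub: "E\<^sub>1 \<union> E\<^sub>1\<inverse> \<subseteq> ?E \<union> ?E\<inverse>" "E\<^sub>2 \<union> E\<^sub>2\<inverse> \<subseteq> ?E \<union> ?E\<inverse>"
    and arc: "(b + 1, b) \<in> ?E \<union> ?E\<inverse>" "(b + 1 + n\<^sub>1, b) \<in> ?E \<union> ?E\<inverse>"
    by auto
  note left = relpow_le_extend[OF _ sub(1) arc(1)] and right = relpow_le_extend[OF _ sub(2) arc(2)]
  {
    case 1
    then consider "u = b" | "u \<in> {b + 1..<b + 1 + n\<^sub>1}" | "u \<in> {b + 1 + n\<^sub>1..<b + 1 + n\<^sub>1 + n\<^sub>2}"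
      unfolding atLeastLessThan_iff by linarith
    then show ?case
    proof cases
      case 1 then show ?thesis by (intro exI[of _ 0]) simp
    next
      case 2 show ?thesis using left[OF node.IH(1)[OF 2 \<open>0 < m\<close>]] unfolding add_Suc .
    next
      case 3 show ?thesis using right[OF node.IH(3)[OF 3 \<open>0 < m\<close>]] unfolding add_Suc .
    qed
  next
    case (2 r)
    from 2(1) show ?case
    proof
      assume "r \<in> R\<^sub>1"
      then show ?case by (rule left[OF node.IH(2)[OF _ \<open>0 < m\<close>]])
    next
      assume "r \<in> R\<^sub>2"
      then show ?case by (rule right[OF node.IH(4)[OF _ \<open>0 < m\<close>]])
    qed
  }
qed

text \<open>Split k into halves at each node. A leaf may stand at any remaining depth, which settles
  k = 1; b varies because the right subtree is numbered after the left one.\<close>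

lemma ex_gadget_tree:
  assumes "0 < m" "0 < k" "k \<le> 2 ^ l"
  shows "\<exists>n R E. gadget_tree m l b n R E \<and> card R = k"
  using assms(2,3)
proof (induction l arbitrary: k b)
  case 0
  then have "k = 1" by simp
  then show ?case using gadget_tree.leaf[of m 0 b] by (intro exI conjI) auto
next
  case (Suc l)
  show ?case
  proof (cases "k = 1")
    case True
    then show ?thesis using gadget_tree.leaf[of m "Suc l" b] by (intro exI conjI) auto
  next
    case False
    have "0 < k div 2" "k div 2 \<le> 2 ^ l" "0 < k - k div 2" "k - k div 2 \<le> 2 ^ l"
      using Suc.prems False by auto
    note k = this
    obtain n\<^sub>1 R\<^sub>1 E\<^sub>1 where 1: "gadget_tree m l (b + 1) n\<^sub>1 R\<^sub>1 E\<^sub>1" "card R\<^sub>1 = k div 2"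
      using Suc.IH[OF k(1,2)] by blast
    obtain n\<^sub>2 R\<^sub>2 E\<^sub>2 where
      2: "gadget_tree m l (b + 1 + n\<^sub>1) n\<^sub>2 R\<^sub>2 E\<^sub>2" "card R\<^sub>2 = k - k div 2"
      using Suc.IH[OF k(3,4)] by blast
    have "R\<^sub>1 \<inter> R\<^sub>2 = {}"
      using gadget_tree_roots[OF 1(1)] gadget_tree_roots[OF 2(1)] \<open>0 < m\<close> by force
    then have "card (R\<^sub>1 \<union> R\<^sub>2) = k"
      using 1 2 gadget_tree_card \<open>0 < m\<close> by (subst card_Un_disjoint) auto
    then show ?thesis using gadget_tree.node[OF 1(1) 2(1)] by blast
  qed
qed

section \<open>The graph of a gadget tree\<close>

locale gadget_tree_graph =
  fixes m l n :: nat and R :: "nat set" and E :: "nat rel"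
  assumes tree: "gadget_tree m l 0 n R E" and depth: "2 * l + 2 \<le> m"
    and R_nonempty: "R \<noteq> {}"
begin

definition A :: "nat rel" where "A = E \<union> E\<inverse>"

lemma A_iff: "(u, v) \<in> A \<longleftrightarrow> (u, v) \<in> E \<or> (v, u) \<in> E"
  by (simp add: A_def)

abbreviation T :: "nat pair_pre_digraph" where "T \<equiv> \<lparr>pverts = {0..<n}, parcs = A\<rparr>"

lemma m_ge_2: "2 \<le> m" and m_pos: "0 < m"
  using depth by simp_all

lemma edges: "(u, v) \<in> E \<Longrightarrow> u < v \<and> v < n"
  using gadget_tree_edges[OF tree m_pos] by fastforce

lemma arcs_in: "(u, v) \<in> A \<Longrightarrow> u < n \<and> v < n \<and> u \<noteq> v"
  using edges[of u v] edges[of v u] by (auto simp: A_iff)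

lemma pair_graph_T: "pair_graph T"
proof
  show "finite (parcs T)"
    by (rule finite_subset[of _ "{0..<n} \<times> {0..<n}"]) (auto dest: arcs_in)
  show "symmetric T" by (auto simp: symmetric_def sym_def A_iff)
qed (auto dest: arcs_in)

lemma relpow_sym: "(u, v) \<in> A ^^ i \<Longrightarrow> (v, u) \<in> A ^^ i"
proof (induction i arbitrary: v)
  case (Suc i)
  then obtain w where "(u, w) \<in> A ^^ i" "(w, v) \<in> A" by auto
  then have "(v, w) \<in> A" "(w, u) \<in> A ^^ i" using Suc.IH by (auto simp: A_iff)
  then show ?case by (rule relpow_Suc_I2)
qed simp

lemma walk_to_root:
  assumes "u < n" "r \<in> R"
  shows "\<exists>i\<le>4 * m - 2. (u, r) \<in> A ^^ i"
proof -
  obtain i where i: "i \<le> l + 3 * m" "(u, 0) \<in> A ^^ i"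
    using gadget_tree_walks(1)[OF tree m_pos, of u, folded A_def] assms(1) by auto
  obtain j where j: "j \<le> l" "(r, 0) \<in> A ^^ j"
    using gadget_tree_walks(2)[OF tree m_pos assms(2), folded A_def] by auto
  have "(u, r) \<in> A ^^ (i + j)" by (rule relpow_trans[OF i(2) relpow_sym[OF j(2)]])
  \<comment> \<open>The detour through the tree root costs at most 2l + 3m, which
    \<open>depth\<close> bounds by 4m - 2.\<close>
  moreover have "i + j \<le> 4 * m - 2" using i(1) j(1) depth by simp
  ultimately show ?thesis by blast
qed

lemma reach: "u < n \<Longrightarrow> v < n \<Longrightarrow> (u, v) \<in> A\<^sup>*"
proof -
  assume u: "u < n" "v < n"
  obtain r where "r \<in> R" using R_nonempty by blast
  then obtain i j where "(u, r) \<in> A ^^ i" "(v, r) \<in> A ^^ j" using walk_to_root u by blast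
  then have "(u, v) \<in> A ^^ (i + j)" by (intro relpow_trans[OF _ relpow_sym])
  then show ?thesis by (rule relpow_imp_rtrancl)
qed

lemma connected_T: "Digraph_Component.connected (with_proj T)"
proof -
  have A: "A\<^sup>s = A" by (auto simp: symcl_def A_iff)
  have "(u, v) \<in> rtrancl_on {0..<n} A" if "u < n" "v < n" for u v
    using reach[OF that] by (rule rtrancl_consistent_rtrancl_on) (use that in \<open>auto dest: arcs_in\<close>)
  moreover have "0 < n" using gadget_tree_pos[OF tree m_pos] .
  ultimately show ?thesis
    unfolding connected_conv by (auto simp: A)
qed

lemma outerplanar_T: "outerplanar T"
  unfolding A_def
proof (rule outerplanar_if_noncrossing)
  show "u \<in> {0..<n} \<and> v \<in> {0..<n} \<and> u < v" if "(u, v) \<in> E" for u v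
    using edges[OF that] by auto
qed (rule gadget_tree_noncrossing[OF tree m_pos])

lemma gadget_in_T: "r \<in> R \<Longrightarrow> gadget_in_graph T m r"
proof -
  assume r: "r \<in> R"
  interpret pair_graph T by (rule pair_graph_T)
  have rn: "r + 8 * m \<le> n" using gadget_tree_roots[OF tree r] by simp
  note g = gadget_tree_gadget[OF tree m_pos r]
  show ?thesis
  proof
    show "(u, w) \<in> parcs T \<longleftrightarrow> gadget_adj (int m) (int u - int r) (int w - int r)"
      if "u \<in> {r..<r + 8 * m}" "w \<in> {r..<r + 8 * m}" for u w
      using g(1)[OF that] g(1)[OF that(2,1)] by (simp add: A_iff)
    show "u = r" if "(u, w) \<in> parcs T" "u \<in> {r..<r + 8 * m}" "w \<notin> {r..<r + 8 * m}" for u w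
      using that g(2)[of u w] g(3)[of w u] by (auto simp: A_iff)
    show "(u, r) \<in> (parcs T)\<^sup>*" if "u \<in> pverts T" for u
      using reach[of u r] that rn m_pos by simp
  qed (use m_ge_2 rn in auto)
qed

lemma max_degree_T: "max_degree T = 3"
proof -
  have arcs: "out_arcs (with_proj T) v = Pair v ` {w. (v, w) \<in> A}" for v
    by (auto simp: out_arcs_def)
  have deg: "out_degree (with_proj T) v = card {w. (v, w) \<in> A}" for v
    unfolding out_degree_def arcs by (rule card_image) (auto simp: inj_on_def)
  have fin: "finite {w. (v, w) \<in> A}" for v
    by (rule finite_subset[of _ "{0..<n}"]) (auto dest: arcs_in)
  have le: "card {w. (v, w) \<in> A} \<le> 3" for v
  proof -
    obtain x y z where "\<forall>w. (v, w) \<in> A \<longrightarrow> w \<in> {x, y, z}"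
      using gadget_tree_degree[OF tree m_ge_2, folded A_def] by blast
    then have "card {w. (v, w) \<in> A} \<le> card {x, y, z}" by (intro card_mono) auto
    also have "\<dots> \<le> 3" by (simp add: card_insert_if)
    finally show ?thesis .
  qed
  obtain r where r: "r \<in> R" using R_nonempty by blast
  then interpret gadget_in_graph T m r by (rule gadget_in_T)
  \<comment> \<open>An end of the chord attains degree 3.\<close>
  have "(r + 3 * m, w) \<in> A" if "w \<in> {r + 3 * m - 1, r + 3 * m + 1, r + 7 * m}" for w
  proof -
    have "r + 3 * m \<in> gadget" "w \<in> gadget" using that m_ge_2 by auto
    then show ?thesis
      using gadget_arcs[of "r + 3 * m" w] that m_ge_2 by (auto simp: gadget_edge_def)
  qed
  then have "card {r + 3 * m - 1, r + 3 * m + 1, r + 7 * m} \<le> card {w. (r + 3 * m, w) \<in> A}"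
    by (intro card_mono fin) blast
  moreover have "card {r + 3 * m - 1, r + 3 * m + 1, r + 7 * m} = 3"
    using m_ge_2 by (auto simp: card_insert_if)
  ultimately have "out_degree (with_proj T) (r + 3 * m) = 3"
    using le[of "r + 3 * m"] unfolding deg by linarith
  moreover have "r + 3 * m \<in> pverts T" using gadget_subset m_ge_2 by auto
  ultimately show ?thesis
    unfolding max_degree_def using le deg by (intro Max_eqI) (auto simp: rev_image_eqI)
qed

text \<open>Pigeonhole: the gadgets are disjoint, so choosing a zombie vertex in each is
  injective.\<close>

lemma ex_zombie_free_gadget:
  assumes "length Z < card R"
  shows "\<exists>r\<in>R. set Z \<inter> {r..<r + 8 * m} = {}"
proof (rule ccontr)
  assume "\<not> ?thesis"
  then have "\<forall>r\<in>R. \<exists>z. z \<in> set Z \<and> z \<in> {r..<r + 8 * m}" by blast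
  then obtain f where f: "\<And>r. r \<in> R \<Longrightarrow> f r \<in> set Z \<and> f r \<in> {r..<r + 8 * m}" by metis
  have "inj_on f R"
  proof (rule inj_onI, rule ccontr)
    fix r r' assume "r \<in> R" "r' \<in> R" "f r = f r'" "r \<noteq> r'"
    then show False using f[of r] f[of r'] gadget_tree_disjoint[OF tree, of r r'] by auto
  qed
  then have "card R \<le> card (set Z)" using f by (intro card_inj_on_le) auto
  then show False using assms card_length[of Z] by simp
qed

lemma few_zombies_lose:
  assumes "placement T j Z" "j < card R"
  shows "\<exists>\<sigma>. survivor_winning_strategy T Z \<sigma>"
    and "Z = \<tau> [] \<Longrightarrow> \<not> zombies_winning_strategy T j \<tau>"
proof -
  have Z: "length Z < card R" "set Z \<subseteq> {0..<n}" using assms by (auto simp: placement_def)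
  obtain r where r: "r \<in> R" "set Z \<inter> {r..<r + 8 * m} = {}"
    using ex_zombie_free_gadget[OF Z(1)] by blast
  interpret gadget_in_graph T m r by (rule gadget_in_T[OF r(1)])
  have z: "z \<in> pverts T \<and> z \<notin> gadget \<and> walk_dist (parcs T) r z \<le> 4 * m - 2" if "z \<in> set Z" for z
  proof -
    have "z < n" using that Z by auto
    then obtain i where i: "i \<le> 4 * m - 2" "(z, r) \<in> A ^^ i" using walk_to_root[OF _ r(1)] by blast
    have "walk_dist A r z \<le> 4 * m - 2" using walk_dist_le[OF i(2)] i(1) by (rule le_trans)
    then show ?thesis using that r \<open>z < n\<close> by auto
  qed
  show "\<exists>\<sigma>. survivor_winning_strategy T Z \<sigma>" by (rule survivor_escapes(1)[OF z])
  show "Z = \<tau> [] \<Longrightarrow> \<not> zombies_winning_strategy T j \<tau>" by (rule survivor_escapes(2)[OF z])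
qed

lemma zombie_number_T: "card R \<le> zombie_number T"
proof (rule zombie_number_ge)
  fix j \<tau> assume w: "zombies_winning_strategy T j \<tau>"
  then have "placement T j (\<tau> [])" by (simp add: zombies_winning_strategy_def)
  then show "card R \<le> j" using few_zombies_lose(2)[OF _ _ refl, of j \<tau>] w by linarith
qed simp

end

theorem theorem4:
  fixes k :: nat
  assumes "k \<ge> 2"
  shows "\<exists>G :: nat pair_pre_digraph.
    pair_graph G \<and> Digraph_Component.connected (with_proj G) \<and> outerplanar G \<and>
    max_degree G = 3 \<and>
    int (card (pverts G)) \<le> 24 * int k + 16 * int k * \<lceil>log 2 (real k)\<rceil> - 1 \<and>
    zombie_number G \<ge> k \<and>
    (\<forall>m Z\<^sub>0. m \<le> k - 1 \<and> placement G m Z\<^sub>0 \<longrightarrow> (\<exists>\<sigma>. survivor_winning_strategy G Z\<^sub>0 \<sigma>))"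
proof -
  define l where "l = nat \<lceil>log 2 (real k)\<rceil>"
  define m where "m = 2 * l + 2"
  have "0 \<le> log 2 (real k)" using assms by simp
  then have l: "int l = \<lceil>log 2 (real k)\<rceil>" "log 2 (real k) \<le> real l"
    unfolding l_def by linarith+
  have "real k \<le> 2 powr real l"
    using l(2) assms by (simp add: log_le_iff)
  then have "real k \<le> real (2 ^ l)" by (simp add: powr_realpow)
  then have k: "k \<le> 2 ^ l" using of_nat_le_iff by blast
  have m: "0 < m" by (simp add: m_def)
  obtain n R E where t: "gadget_tree m l 0 n R E" and R: "card R = k"
    using ex_gadget_tree[OF m _ k, of 0] assms by auto
  interpret gadget_tree_graph m l n R E
    using t R assms by unfold_locales (auto simp: m_def)
  have "k * (8 * m + 1) = n + 1" using gadget_tree_card[OF t m] R by simp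
  \<comment> \<open>Here 8m + 1 = 16l + 17, and 17k \<le> 24k gives the stated bound.\<close>
  then have "int n = int k * (16 * int l + 17) - 1"
    by (simp add: m_def algebra_simps flip: of_nat_eq_iff[where 'a = int])
  then have "int (card (pverts T)) \<le> 24 * int k + 16 * int k * \<lceil>log 2 (real k)\<rceil> - 1"
    unfolding l(1)[symmetric] by (simp add: algebra_simps)
  moreover have "\<exists>\<sigma>. survivor_winning_strategy T Z \<sigma>" if "j \<le> k - 1" "placement T j Z" for j Z
    using few_zombies_lose(1)[OF that(2)] that(1) R assms by simp
  ultimately show ?thesis
    using pair_graph_T connected_T outerplanar_T max_degree_T zombie_number_T R
    by (intro exI[of _ T]) auto
qed

end
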